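(* If there exists a constant $c_I>0$ such that $$\inf_{v^h\in\mathcal U^h}\ \sup_{w\in\mathcal Z^{\mathfrak h}}\frac{|\langle v^h,L^*w\rangle|}{\|v^h\|\,\|L^*w\|}\ \ge\ c_I ,$$ then $$c_I^2\,\mathbf v^T\mathbf M\mathbf v\le\mathbf v^T\mathbf A\mathbf v\qquad\text{for all }\mathbf v\in\mathbb R^N .$$ In particular, $\mathbf A$ (as well as the block matrix $\mathbb A$) is nonsingular.
   Context: $\Omega\subset\mathbb R^d$ is a domain; $L^2(\Omega)$ (real-valued) has norm $\|\cdot\|$ and inner product $\langle\cdot,\cdot\rangle$. $L$ is a linear first-order differential operator, regarded as a closed, densely defined unbounded linear operator in $L^2(\Omega)$ with domain $\mathcal D(L)$ (the functions $u\in L^2(\Omega)$ with $Lu\in L^2(\Omega)$ satisfying given homogeneous boundary conditions). $L^*$ with domain $\mathcal D(L^* )$ is its $L^2(\Omega)$-adjoint. Standing assumptions: (i) there is $c_P^*>0$ with $c_P^*\|w\|\le\|L^*w\|$ for all $w\in\mathcal D(L^* )$; (ii) $L^*(\mathcal D(L^* ))=L^2(\Omega)$. $\mathcal U^h\subset\mathcal D(L)$ and $\mathcal Z^{\mathfrak h}\subset\mathcal D(L^* )$ are (nonzero, finite-dimensional) finite element spaces with bases $\{\phi_i\}_{i=1}^N$ and $\{\psi_i\}_{i=1}^M$, respectively. In infima and suprema of quotients only nonzero elements are considered. Define $\mathbf L\in\mathbb R^{M\times N}$, $\mathbf H\in\mathbb R^{M\times M}$, $\mathbf M\in\mathbb R^{N\times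 N}$ by $$(\mathbf L)_{ij}=\langle\phi_j,L^*\psi_i\rangle,\quad(\mathbf H)_{ij}=\langle L^*\psi_j,L^*\psi_i\rangle,\quad(\mathbf M)_{ij}=\langle\phi_j,\phi_i\rangle .$$ By (i), $\mathbf H$ is symmetric positive definite. Set $$\mathbf A=\mathbf L^T\mathbf H^{-1}\mathbf L\in\mathbb R^{N\times N},\qquad \mathbb A=\begin{bmatrix}\mathbf H&\mathbf L\\ \mathbf L^T&0\end{bmatrix}\in\mathbb R^{(M+N)\times(M+N)} .$$ *)

theory Defs
  imports "HOL-Analysis.Analysis"
begin

definition square_integrable :: "('a::euclidean_space \<Rightarrow> real) \<Rightarrow> bool" where
  "square_integrable f \<longleftrightarrow>
     f \<in> borel_measurable lebesgue \<and> integrable lebesgue (\<lambda>x. (f x)\<^sup>2)"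

definition L2_eq :: "('a::euclidean_space \<Rightarrow> real) \<Rightarrow> ('a \<Rightarrow> real) \<Rightarrow> bool" where
  "L2_eq f g \<longleftrightarrow>
     square_integrable f \<and> square_integrable g \<and> (AE x in lebesgue. f x = g x)"

lemma square_integrable_zero: "square_integrable (\<lambda>x. 0)"
  by (simp add: square_integrable_def)

lemma integrable_mult_of_square_integrable:
  assumes "square_integrable f" "square_integrable g"
  shows "integrable lebesgue (\<lambda>x. f x * g x)"
proof (rule Bochner_Integration.integrable_bound)
  show "integrable lebesgue (\<lambda>x. (f x)\<^sup>2 + (g x)\<^sup>2)"
    using assms by (simp add: square_integrable_def)
  show "(\<lambda>x. f x * g x) \<in> borel_measurable lebesgue"
    using assms by (auto simp: square_integrable_def)
  have "norm (f x * g x) \<le> norm ((f x)\<^sup>2 + (g x)\<^sup>2)" for x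
  proof -
    have "0 \<le> (\<bar>f x\<bar> - \<bar>g x\<bar>)\<^sup>2" by simp
    then have "2 * (\<bar>f x\<bar> * \<bar>g x\<bar>) \<le> (f x)\<^sup>2 + (g x)\<^sup>2" by (simp add: power2_diff mult.assoc)
    moreover have "0 \<le> \<bar>f x\<bar> * \<bar>g x\<bar>" by simp
    ultimately have "\<bar>f x\<bar> * \<bar>g x\<bar> \<le> (f x)\<^sup>2 + (g x)\<^sup>2" by linarith
    then show ?thesis by (simp add: abs_mult)
  qed
  then show "AE x in lebesgue. norm (f x * g x) \<le> norm ((f x)\<^sup>2 + (g x)\<^sup>2)" by simp
qed

lemma square_integrable_add:
  assumes "square_integrable f" "square_integrable g"
  shows "square_integrable (\<lambda>x. f x + g x)"
proof -
  have "integrable lebesgue (\<lambda>x. (f x)\<^sup>2 + (g x)\<^sup>2 + 2 * (f x * g x))"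
    using assms integrable_mult_of_square_integrable[OF assms]
    by (simp add: square_integrable_def)
  moreover have "(\<lambda>x. (f x)\<^sup>2 + (g x)\<^sup>2 + 2 * (f x * g x)) = (\<lambda>x. (f x + g x)\<^sup>2)"
    by (simp add: power2_sum mult.assoc)
  ultimately show ?thesis
    using assms by (auto simp: square_integrable_def)
qed

lemma square_integrable_scale:
  assumes "square_integrable f"
  shows "square_integrable (\<lambda>x. r * f x)"
  using assms by (auto simp: square_integrable_def power_mult_distrib)

lemma square_integrable_uminus: "square_integrable f \<Longrightarrow> square_integrable (\<lambda>x. - f x)"
  by (auto simp: square_integrable_def)

lemma square_integrable_diff:
  "square_integrable f \<Longrightarrow> square_integrable g \<Longrightarrow> square_integrable (\<lambda>x. f x - g x)"
  using square_integrable_add[of f "\<lambda>x. - g x"] square_integrable_uminus[of g] by simp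

quotient_type (overloaded) 'a L2 = "'a::euclidean_space \<Rightarrow> real" / partial: L2_eq
proof (rule part_equivpI)
  show "\<exists>f::'a \<Rightarrow> real. L2_eq f f"
    using square_integrable_zero by (auto simp: L2_eq_def)
  show "symp (L2_eq :: ('a \<Rightarrow> real) \<Rightarrow> _)"
    by (auto simp: symp_def L2_eq_def eq_commute)
  show "transp (L2_eq :: ('a \<Rightarrow> real) \<Rightarrow> _)"
    unfolding transp_def L2_eq_def by (auto elim: eventually_elim2)
qed

instantiation L2 :: (euclidean_space) real_vector
begin

lift_definition zero_L2 :: "'a L2" is "\<lambda>x. 0"
  by (simp add: L2_eq_def square_integrable_zero)

lift_definition plus_L2 :: "'a L2 \<Rightarrow> 'a L2 \<Rightarrow> 'a L2" is "\<lambda>f g x. f x + g x"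
  by (auto simp: L2_eq_def square_integrable_add)

lift_definition uminus_L2 :: "'a L2 \<Rightarrow> 'a L2" is "\<lambda>f x. - f x"
  by (auto simp: L2_eq_def square_integrable_uminus)

lift_definition minus_L2 :: "'a L2 \<Rightarrow> 'a L2 \<Rightarrow> 'a L2" is "\<lambda>f g x. f x - g x"
  by (auto simp: L2_eq_def square_integrable_diff)

lift_definition scaleR_L2 :: "real \<Rightarrow> 'a L2 \<Rightarrow> 'a L2" is "\<lambda>r f x. r * f x"
  by (auto simp: L2_eq_def square_integrable_scale)

instance
proof
  fix u v w :: "'a L2" and r s :: real
  show "u + v + w = u + (v + w)"
    by transfer (auto simp: L2_eq_def square_integrable_add add.assoc)
  show "u + v = v + u"
    by transfer (auto simp: L2_eq_def square_integrable_add add.commute)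
  show "0 + u = u"
    by transfer (auto simp: L2_eq_def)
  show "- u + u = 0"
    by transfer (auto simp: L2_eq_def square_integrable_zero)
  show "u - v = u + - v"
    by transfer (auto simp: L2_eq_def square_integrable_diff)
  show "r *\<^sub>R (u + v) = r *\<^sub>R u + r *\<^sub>R v"
    by transfer (auto simp: L2_eq_def square_integrable_add square_integrable_scale distrib_left
        intro!: square_integrable_add)
  show "(r + s) *\<^sub>R u = r *\<^sub>R u + s *\<^sub>R u"
    by transfer (auto simp: L2_eq_def distrib_right
        intro!: square_integrable_add square_integrable_scale)
  show "r *\<^sub>R s *\<^sub>R u = (r * s) *\<^sub>R u"
    by transfer (auto simp: L2_eq_def mult.assoc intro!: square_integrable_scale)
  show "1 *\<^sub>R u = u"
    by transfer (auto simp: L2_eq_def)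
qed

end

instantiation L2 :: (euclidean_space) real_inner
begin

lift_definition inner_L2 :: "'a L2 \<Rightarrow> 'a L2 \<Rightarrow> real" is
  "\<lambda>f g. LINT x|lebesgue. f x * g x"
  by (rule integral_cong_AE) (auto simp: L2_eq_def square_integrable_def)

definition norm_L2 :: "'a L2 \<Rightarrow> real" where "norm_L2 u = sqrt (u \<bullet> u)"
definition dist_L2 :: "'a L2 \<Rightarrow> 'a L2 \<Rightarrow> real" where "dist_L2 u v = norm (u - v)"
definition sgn_L2 :: "'a L2 \<Rightarrow> 'a L2" where "sgn_L2 u = u /\<^sub>R norm u"
definition uniformity_L2 :: "('a L2 \<times> 'a L2) filter" where
  "uniformity_L2 = (INF e\<in>{0 <..}. principal {(u, v). dist u v < e})"
definition open_L2 :: "'a L2 set \<Rightarrow> bool" where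
  "open_L2 S = (\<forall>u\<in>S. \<forall>\<^sub>F (u', v) in uniformity. u' = u \<longrightarrow> v \<in> S)"

instance
proof
  fix u v w :: "'a L2" and r :: real
  show "dist u v = norm (u - v)" by (rule dist_L2_def)
  show "sgn u = u /\<^sub>R norm u" by (rule sgn_L2_def)
  show "uniformity = (INF e\<in>{0 <..}. principal {(u, v::'a L2). dist u v < e})"
    by (rule uniformity_L2_def)
  show "open S = (\<forall>u\<in>S. \<forall>\<^sub>F (u', v) in uniformity. u' = u \<longrightarrow> v \<in> S)" for S :: "'a L2 set"
    by (rule open_L2_def)
  show "u \<bullet> v = v \<bullet> u"
    by transfer (simp add: mult.commute)
  show "(u + v) \<bullet> w = u \<bullet> w + v \<bullet> w"
    by transfer
      (auto simp: L2_eq_def distrib_right intro!: Bochner_Integration.integral_add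
        integrable_mult_of_square_integrable)
  show "(r *\<^sub>R u) \<bullet> v = r * (u \<bullet> v)"
    by transfer (simp add: mult.assoc)
  show "0 \<le> u \<bullet> u"
    by transfer simp
  show "(u \<bullet> u = 0) = (u = 0)"
  proof transfer
    fix f :: "'a \<Rightarrow> real"
    assume f: "L2_eq f f"
    then have "integrable lebesgue (\<lambda>x. f x * f x)"
      by (simp add: L2_eq_def square_integrable_def power2_eq_square)
    then have "(LINT x|lebesgue. f x * f x) = 0 \<longleftrightarrow> (AE x in lebesgue. f x * f x = 0)"
      by (intro integral_nonneg_eq_0_iff_AE) auto
    then show "((LINT x|lebesgue. f x * f x) = 0) = L2_eq f (\<lambda>x. 0)"
      using f by (auto simp: L2_eq_def square_integrable_zero)
  qed
  show "norm u = sqrt (u \<bullet> u)" by (rule norm_L2_def)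
qed

end

text \<open>
  \<^term>\<open>L2_on \<Omega>\<close> is the space of square-integrable functions on \<open>\<Omega>\<close>, each identified with its
  extension by zero; norm and inner product are then those of the ambient type.
\<close>

lift_definition vanishes_off :: "'a::euclidean_space set \<Rightarrow> 'a L2 \<Rightarrow> bool" is
  "\<lambda>\<Omega> f. AE x in lebesgue. x \<notin> \<Omega> \<longrightarrow> f x = 0"
  unfolding L2_eq_def by (auto elim: eventually_elim2)

definition L2_on :: "'a::euclidean_space set \<Rightarrow> 'a L2 set" where
  "L2_on \<Omega> = {u. vanishes_off \<Omega> u}"

text \<open>
  An unbounded operator in a closed subspace \<open>H\<close> is given by its domain \<open>D\<close> and a total function
  \<open>T\<close>, of which only the values on \<open>D\<close> matter.
\<close>

definition closed_densely_defined ::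
    "'a::real_inner set \<Rightarrow> 'a set \<Rightarrow> ('a \<Rightarrow> 'a) \<Rightarrow> bool" where
  "closed_densely_defined H D T \<longleftrightarrow>
     subspace D \<and> D \<subseteq> H \<and> T ` D \<subseteq> H \<and>
     (\<forall>u\<in>D. \<forall>v\<in>D. T (u + v) = T u + T v) \<and> (\<forall>r. \<forall>u\<in>D. T (r *\<^sub>R u) = r *\<^sub>R T u) \<and>
     H \<subseteq> closure D \<and> closed {(u, T u) | u. u \<in> D}"

definition adjoint_domain ::
    "'a::real_inner set \<Rightarrow> 'a set \<Rightarrow> ('a \<Rightarrow> 'a) \<Rightarrow> 'a set" where
  "adjoint_domain H D T = {w \<in> H. \<exists>z\<in>H. \<forall>u\<in>D. T u \<bullet> w = u \<bullet> z}"

text \<open>The value is unique for \<open>w\<close> in the adjoint domain, as \<open>D\<close> is dense in \<open>H\<close>.\<close>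

definition adjoint_op ::
    "'a::real_inner set \<Rightarrow> 'a set \<Rightarrow> ('a \<Rightarrow> 'a) \<Rightarrow> 'a \<Rightarrow> 'a" where
  "adjoint_op H D T w = (THE z. z \<in> H \<and> (\<forall>u\<in>D. T u \<bullet> w = u \<bullet> z))"

fun C_k :: "nat \<Rightarrow> ('a::euclidean_space \<Rightarrow> real) \<Rightarrow> bool" where
  "C_k 0 f \<longleftrightarrow> continuous_on UNIV f"
| "C_k (Suc k) f \<longleftrightarrow>
     (\<forall>x. f differentiable (at x)) \<and> (\<forall>v. C_k k (\<lambda>x. frechet_derivative f (at x) v))"

definition test_functions :: "'a::euclidean_space set \<Rightarrow> ('a \<Rightarrow> real) set" where
  "test_functions \<Omega> =
     {\<phi>. (\<forall>k. C_k k \<phi>) \<and> (\<exists>K. compact K \<and> K \<subseteq> \<Omega> \<and> (\<forall>x. x \<notin> K \<longrightarrow> \<phi> x = 0))}"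

definition L2_loc :: "'a::euclidean_space set \<Rightarrow> ('a \<Rightarrow> 'b::euclidean_space) \<Rightarrow> bool" where
  "L2_loc \<Omega> f \<longleftrightarrow> set_borel_measurable lebesgue \<Omega> f \<and>
     (\<forall>K. compact K \<and> K \<subseteq> \<Omega> \<longrightarrow> set_integrable lebesgue K (\<lambda>x. (norm (f x))\<^sup>2))"

lemma lebesgue_integral_cong_AE:
  fixes f g :: "'a::euclidean_space \<Rightarrow> real"
  assumes eq: "AE x in lebesgue. f x = g x"
  shows "(LINT x|lebesgue. f x) = (LINT x|lebesgue. g x)"
proof -
  have meas: "h \<in> borel_measurable lebesgue"
    if "k \<in> borel_measurable lebesgue" "AE x in lebesgue. k x = h x" for h k :: "'a \<Rightarrow> real"
    using that by (rule borel_measurable_AE)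
  show ?thesis
  proof (cases "f \<in> borel_measurable lebesgue")
    case True
    then show ?thesis using meas[OF True eq] eq by (intro integral_cong_AE)
  next
    case False
    have "AE x in lebesgue. g x = f x" using eq by (auto elim: eventually_mono)
    then have "g \<notin> borel_measurable lebesgue" using meas[of g f] False by blast
    then show ?thesis using False
      by (metis borel_measurable_integrable not_integrable_integral_eq)
  qed
qed

text \<open>
  \<open>div (b u) + c u = g\<close> in the sense of distributions on \<open>\<Omega>\<close>. Locally square-integrable
  coefficients are what gives this a meaning for every square-integrable \<open>u\<close>; the advective form
  \<open>b \<bullet> grad u + a u\<close> is the case \<open>c = a - div b\<close>. Note that \<open>b x \<bullet> grad \<phi> x\<close> is the
  derivative of \<open>\<phi>\<close> at \<open>x\<close> in direction \<open>b x\<close>.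
\<close>

lift_definition distributional_eq ::
    "'a::euclidean_space set \<Rightarrow> ('a \<Rightarrow> 'a) \<Rightarrow> ('a \<Rightarrow> real) \<Rightarrow> 'a L2 \<Rightarrow> 'a L2 \<Rightarrow> bool" is
  "\<lambda>\<Omega> b c u g. \<forall>\<phi>\<in>test_functions \<Omega>.
     (LINT x:\<Omega>|lebesgue. g x * \<phi> x) =
     (LINT x:\<Omega>|lebesgue. u x * (c x * \<phi> x - frechet_derivative \<phi> (at x) (b x)))"
  unfolding L2_eq_def set_lebesgue_integral_def
  by (intro iffI ext ball_cong refl arg_cong2[where f="(=)"] lebesgue_integral_cong_AE)
    (auto elim: eventually_mono)

text \<open>
  \<open>B\<close> is the set of functions satisfying the homogeneous boundary conditions. The conditions being
  linear and homogeneous, \<open>B\<close> is a subspace; being conditions at the boundary, they hold for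
  every function that vanishes outside a compact subset of \<open>\<Omega>\<close>.
\<close>

definition first_order_operator ::
    "'a::euclidean_space set \<Rightarrow> ('a \<Rightarrow> 'a) \<Rightarrow> ('a \<Rightarrow> real) \<Rightarrow> 'a L2 set \<Rightarrow>
     'a L2 set \<Rightarrow> ('a L2 \<Rightarrow> 'a L2) \<Rightarrow> bool" where
  "first_order_operator \<Omega> b c B D L \<longleftrightarrow>
     L2_loc \<Omega> b \<and> L2_loc \<Omega> c \<and>
     subspace B \<and> (\<forall>K. compact K \<and> K \<subseteq> \<Omega> \<longrightarrow> L2_on K \<subseteq> B) \<and>
     D = {u \<in> L2_on \<Omega>. u \<in> B \<and> (\<exists>g\<in>L2_on \<Omega>. distributional_eq \<Omega> b c u g)} \<and>
     (\<forall>u\<in>D. L u \<in> L2_on \<Omega> \<and> distributional_eq \<Omega> b c u (L u))"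

definition is_basis_of :: "('i::finite \<Rightarrow> 'a::real_vector) \<Rightarrow> 'a set \<Rightarrow> bool" where
  "is_basis_of \<phi> V \<longleftrightarrow> inj \<phi> \<and> independent (range \<phi>) \<and> span (range \<phi>) = V"

text \<open>In the type \<open>real^'n^'m\<close> of matrices the row index \<open>i\<close> comes first.\<close>

definition mat_L ::
    "('b \<Rightarrow> 'b) \<Rightarrow> ('n \<Rightarrow> 'b::real_inner) \<Rightarrow> ('m \<Rightarrow> 'b) \<Rightarrow> real^'n^'m" where
  "mat_L Ls \<phi> \<psi> = (\<chi> i j. \<phi> j \<bullet> Ls (\<psi> i))"

definition mat_H :: "('b \<Rightarrow> 'b::real_inner) \<Rightarrow> ('m \<Rightarrow> 'b) \<Rightarrow> real^'m^'m" where
  "mat_H Ls \<psi> = (\<chi> i j. Ls (\<psi> j) \<bullet> Ls (\<psi> i))"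

definition mat_M :: "('n \<Rightarrow> 'b::real_inner) \<Rightarrow> real^'n^'n" where
  "mat_M \<phi> = (\<chi> i j. \<phi> j \<bullet> \<phi> i)"

definition mat_A ::
    "('b \<Rightarrow> 'b) \<Rightarrow> ('n::finite \<Rightarrow> 'b::real_inner) \<Rightarrow> ('m::finite \<Rightarrow> 'b) \<Rightarrow> real^'n^'n" where
  "mat_A Ls \<phi> \<psi> =
     transpose (mat_L Ls \<phi> \<psi>) ** matrix_inv (mat_H Ls \<psi>) ** mat_L Ls \<phi> \<psi>"

definition block_matrix ::
    "real^'m^'m \<Rightarrow> real^'n^'m \<Rightarrow> real^'m^'n \<Rightarrow> real^'n^'n \<Rightarrow> real^('m + 'n)^('m + 'n)" where
  "block_matrix P Q R S = (\<chi> i j. case i of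
       Inl i' \<Rightarrow> (case j of Inl j' \<Rightarrow> P $ i' $ j' | Inr j' \<Rightarrow> Q $ i' $ j')
     | Inr i' \<Rightarrow> (case j of Inl j' \<Rightarrow> R $ i' $ j' | Inr j' \<Rightarrow> S $ i' $ j'))"

definition mat_AA ::
    "('b \<Rightarrow> 'b) \<Rightarrow> ('n::finite \<Rightarrow> 'b::real_inner) \<Rightarrow> ('m::finite \<Rightarrow> 'b) \<Rightarrow>
     real^('m + 'n)^('m + 'n)" where
  "mat_AA Ls \<phi> \<psi> =
     block_matrix (mat_H Ls \<psi>) (mat_L Ls \<phi> \<psi>) (transpose (mat_L Ls \<phi> \<psi>)) 0"

end

theory Submission
  imports Defs
begin

text \<open>
  Write \<open>P v = \<Sum>\<^sub>i v\<^sub>i \<phi>\<^sub>i\<close> and \<open>T x = \<Sum>\<^sub>i x\<^sub>i L\<^sup>*\<psi>\<^sub>i\<close>. Then \<open>v\<^sup>TMv = \<parallel>P v\<parallel>\<^sup>2\<close>, \<open>x\<^sup>THx = \<parallel>T x\<parallel>\<^sup>2\<close> and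
  \<open>x\<^sup>TLv = \<langle>P v, T x\<rangle>\<close>. If \<open>y\<close> solves \<open>Hy = Lv\<close>, then \<open>T y\<close> is the orthogonal projection of \<open>P v\<close> onto
  the range of \<open>T\<close> and \<open>v\<^sup>TAv = \<parallel>T y\<parallel>\<^sup>2\<close>. By the Cauchy-Schwarz inequality the supremum in the
  inf-sup condition is at most \<open>\<parallel>T y\<parallel> / \<parallel>P v\<parallel>\<close>. The kernel of the block matrix is trivial because
  \<open>A\<close> is, up to sign, the Schur complement of \<open>H\<close>.
\<close>

section \<open>The adjoint operator\<close>

lemma subspace_L2_on: "subspace (L2_on \<Omega> :: 'a::euclidean_space L2 set)"
proof -
  have "vanishes_off \<Omega> (0 :: 'a L2)"
    by transfer simp
  moreover have "vanishes_off \<Omega> (u + v)" if "vanishes_off \<Omega> u" "vanishes_off \<Omega> v" for u v :: "'a L2"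
    using that by transfer (auto elim: eventually_elim2)
  moreover have "vanishes_off \<Omega> (r *\<^sub>R u)" if "vanishes_off \<Omega> u" for r and u :: "'a L2"
    using that by transfer (auto elim: eventually_mono)
  ultimately show ?thesis
    unfolding L2_on_def subspace_def by blast
qed

text \<open>Well-definedness of the description in \<open>adjoint_op\<close>. The vectors
  \<open>u\<close> with equal inner products form a closed set containing \<open>D\<close>, hence by
  density all of \<open>H\<close>. Since \<open>z\<close> and \<open>z'\<close> lie in
  \<open>H\<close>, each may itself be taken as \<open>u\<close>, which gives
  \<open>(z - z') \<bullet> (z - z') = 0\<close>.\<close>

lemma adjoint_value_unique:
  assumes "closed_densely_defined H D T"
    and "z \<in> H" "z' \<in> H"
    and "\<And>u. u \<in> D \<Longrightarrow> u \<bullet> z = u \<bullet> z'"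
  shows "z = z'"
proof -
  have "closed {u. u \<bullet> z = u \<bullet> z'}"
    by (intro closed_Collect_eq continuous_intros)
  moreover have "D \<subseteq> {u. u \<bullet> z = u \<bullet> z'}"
    using assms(4) by auto
  ultimately have "closure D \<subseteq> {u. u \<bullet> z = u \<bullet> z'}"
    by (rule closure_minimal[rotated])
  then have "H \<subseteq> {u. u \<bullet> z = u \<bullet> z'}"
    using assms(1) by (auto simp: closed_densely_defined_def)
  then have "z \<bullet> z = z \<bullet> z'" "z' \<bullet> z = z' \<bullet> z'"
    using assms(2,3) by auto
  then have "(z - z') \<bullet> (z - z') = 0"
    by (simp add: inner_diff_left inner_diff_right)
  then show ?thesis by simp
qed

lemma adjoint_op_eqI:
  assumes "closed_densely_defined H D T" "z \<in> H" "\<And>u. u \<in> D \<Longrightarrow> T u \<bullet> w = u \<bullet> z"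
  shows "adjoint_op H D T w = z"
  unfolding adjoint_op_def
proof (rule the_equality)
  show "z' = z" if "z' \<in> H \<and> (\<forall>u\<in>D. T u \<bullet> w = u \<bullet> z')" for z'
    using that assms by (intro adjoint_value_unique[OF assms(1)]) auto
qed (use assms in auto)

lemma adjoint_op_mem:
  assumes "closed_densely_defined H D T" "w \<in> adjoint_domain H D T"
  shows "adjoint_op H D T w \<in> H"
    and "u \<in> D \<Longrightarrow> T u \<bullet> w = u \<bullet> adjoint_op H D T w"
proof -
  obtain z where z: "z \<in> H" "\<And>u. u \<in> D \<Longrightarrow> T u \<bullet> w = u \<bullet> z"
    using assms(2) by (auto simp: adjoint_domain_def)
  with adjoint_op_eqI[OF assms(1) z]
  show "adjoint_op H D T w \<in> H" "u \<in> D \<Longrightarrow> T u \<bullet> w = u \<bullet> adjoint_op H D T w"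
    by auto
qed

text \<open>Linearity is not built into a definite description. Sums and multiples of adjoint values
  satisfy the defining identity for the sum or multiple of the arguments, and uniqueness then
  identifies them.\<close>

lemma adjoint_linear:
  assumes T: "closed_densely_defined H D T" and H: "subspace H"
  shows subspace_adjoint_domain: "subspace (adjoint_domain H D T)"
    and adjoint_op_add: "\<And>v w. v \<in> adjoint_domain H D T \<Longrightarrow> w \<in> adjoint_domain H D T \<Longrightarrow>
      adjoint_op H D T (v + w) = adjoint_op H D T v + adjoint_op H D T w"
    and adjoint_op_scaleR: "\<And>r w. w \<in> adjoint_domain H D T \<Longrightarrow>
      adjoint_op H D T (r *\<^sub>R w) = r *\<^sub>R adjoint_op H D T w"
proof -
  let ?A = "adjoint_domain H D T" and ?S = "adjoint_op H D T"
  note mem = adjoint_op_mem[OF T]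
  have add: "?S v + ?S w \<in> H" "\<And>u. u \<in> D \<Longrightarrow> T u \<bullet> (v + w) = u \<bullet> (?S v + ?S w)"
    if "v \<in> ?A" "w \<in> ?A" for v w
    using mem[OF that(1)] mem[OF that(2)] by (auto simp: inner_add_right subspace_add[OF H])
  have scale: "r *\<^sub>R ?S w \<in> H" "\<And>u. u \<in> D \<Longrightarrow> T u \<bullet> (r *\<^sub>R w) = u \<bullet> (r *\<^sub>R ?S w)"
    if "w \<in> ?A" for r w
    using mem[OF that] by (auto simp: subspace_scale[OF H])
  have A_H: "?A \<subseteq> H"
    by (auto simp: adjoint_domain_def)
  show "?S (v + w) = ?S v + ?S w" if "v \<in> ?A" "w \<in> ?A" for v w
    using add[OF that] by (intro adjoint_op_eqI[OF T])
  show "?S (r *\<^sub>R w) = r *\<^sub>R ?S w" if "w \<in> ?A" for r w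
    using scale[OF that] by (intro adjoint_op_eqI[OF T])
  show "subspace ?A"
  proof (rule subspaceI)
    show "0 \<in> ?A"
      using subspace_0[OF H] by (auto simp: adjoint_domain_def intro!: bexI[of _ 0])
    show "v + w \<in> ?A" if "v \<in> ?A" "w \<in> ?A" for v w
      using add[OF that] subspace_add[OF H] A_H that unfolding adjoint_domain_def by blast
    show "r *\<^sub>R w \<in> ?A" if "w \<in> ?A" for r w
      using scale[OF that] subspace_scale[OF H] A_H that unfolding adjoint_domain_def by blast
  qed
qed

section \<open>Linear combinations and matrices\<close>

definition lincomb :: "('i::finite \<Rightarrow> 'a::real_vector) \<Rightarrow> real^'i \<Rightarrow> 'a" where
  "lincomb f x = (\<Sum>i\<in>UNIV. x $ i *\<^sub>R f i)"

lemma inner_mat_L: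
  "x \<bullet> (mat_L Ls \<phi> \<psi> *v v) = lincomb \<phi> v \<bullet> lincomb (\<lambda>i. Ls (\<psi> i)) x"
proof -
  have "x \<bullet> (mat_L Ls \<phi> \<psi> *v v)
      = (\<Sum>i\<in>UNIV. \<Sum>j\<in>UNIV. x $ i * (v $ j * (\<phi> j \<bullet> Ls (\<psi> i))))"
    by (simp add: inner_vec_def matrix_vector_mult_def mat_L_def sum_distrib_left mult.commute)
  also have "\<dots> = lincomb \<phi> v \<bullet> lincomb (\<lambda>i. Ls (\<psi> i)) x"
    by (simp add: lincomb_def inner_sum_left inner_sum_right sum_distrib_left mult.left_commute)
  finally show ?thesis .
qed

lemma inner_mat_H:
  "x \<bullet> (mat_H Ls \<psi> *v y) = lincomb (\<lambda>i. Ls (\<psi> i)) y \<bullet> lincomb (\<lambda>i. Ls (\<psi> i)) x"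
  \<comment> \<open>With \<open>id\<close> as operator and the images \<open>Ls (\<psi> i)\<close>
    as both families, \<open>mat_L\<close> becomes the Gram matrix \<open>mat_H\<close>.\<close>
  using inner_mat_L[of x id "\<lambda>i. Ls (\<psi> i)" "\<lambda>i. Ls (\<psi> i)" y]
  by (simp add: mat_H_def mat_L_def)

lemma inner_mat_M: "x \<bullet> (mat_M \<phi> *v y) = lincomb \<phi> y \<bullet> lincomb \<phi> x"
  using inner_mat_L[of x id \<phi> \<phi> y] by (simp add: mat_M_def mat_L_def)

lemma lincomb_eq_0_imp:
  assumes "is_basis_of f V" "lincomb f x = 0"
  shows "x = 0"
proof -
  have inj: "inj f" and ind: "independent (range f)"
    using assms(1) by (auto simp: is_basis_of_def)
  \<comment> \<open>Independence speaks of the set \<open>range f\<close>, so the coefficients are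
    moved from indices to vectors; injectivity of \<open>f\<close> makes this lossless.\<close>
  have "(\<Sum>v\<in>range f. x $ inv f v *\<^sub>R v) = 0"
    using assms(2) inj by (simp add: sum.reindex lincomb_def)
  then have "x $ inv f (f i) = 0" for i
    using ind independentD[of "range f" "range f" "\<lambda>v. x $ inv f v" "f i"] by simp
  then show ?thesis
    using inj by (simp add: vec_eq_iff)
qed

lemma lincomb_mem:
  assumes "is_basis_of f V"
  shows "lincomb f x \<in> V"
  using assms unfolding is_basis_of_def lincomb_def
  by (auto intro!: span_sum span_scale intro: span_base)

lemma is_basis_of_imp_lincomb:
  assumes "is_basis_of f V" "w \<in> V"
  obtains x where "w = lincomb f x"
proof -
  have inj: "inj f" and "w \<in> span (range f)"
    using assms by (auto simp: is_basis_of_def)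
  then obtain u where "w = (\<Sum>v\<in>range f. u v *\<^sub>R v)"
    by (auto simp: span_finite)
  then have "w = lincomb f (\<chi> i. u (f i))"
    using inj by (simp add: sum.reindex lincomb_def)
  then show thesis by (rule that)
qed

text \<open>Index types are nonempty, so the all-ones coefficient vector is nonzero. This keeps the
  suprema over \<open>Z - {0}\<close> from ranging over the empty set.\<close>

lemma is_basis_of_nontrivial:
  fixes f :: "'i::finite \<Rightarrow> 'a::real_vector"
  assumes "is_basis_of f V"
  shows "V - {0} \<noteq> {}"
proof -
  have "lincomb f 1 \<noteq> 0"
    using lincomb_eq_0_imp[OF assms, of 1] by auto
  then show ?thesis
    using lincomb_mem[OF assms, of 1] by blast
qed

text \<open>The adjoint is a total function that is known to be linear only on its domain. The
  induction therefore has to keep every partial sum inside \<open>V\<close>.\<close>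

lemma linear_on_lincomb:
  assumes V: "subspace V"
    and add: "\<And>v w. v \<in> V \<Longrightarrow> w \<in> V \<Longrightarrow> T (v + w) = T v + T w"
    and scale: "\<And>r w. w \<in> V \<Longrightarrow> T (r *\<^sub>R w) = r *\<^sub>R T w"
    and f: "range f \<subseteq> V"
  shows "T (lincomb f x) = lincomb (\<lambda>i. T (f i)) x"
proof -
  have "T 0 = 0"
    using scale[OF subspace_0[OF V], of 0] by simp
  have "T (\<Sum>i\<in>S. x $ i *\<^sub>R f i) = (\<Sum>i\<in>S. x $ i *\<^sub>R T (f i))"
    if "finite S" for S
    using that
  proof induction
    case empty
    show ?case using \<open>T 0 = 0\<close> by simp
  next
    case (insert i S)
    have "f i \<in> V" for i using f by auto
    moreover from this have "(\<Sum>i\<in>S. x $ i *\<^sub>R f i) \<in> V"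
      by (intro subspace_sum[OF V] subspace_scale[OF V])
    ultimately show ?case
      using insert by (simp add: add scale subspace_scale[OF V])
  qed
  then show ?thesis by (simp add: lincomb_def)
qed

section \<open>Invertibility and block elimination\<close>

lemma invertible_iff_ker:
  fixes X :: "real^'n^'n"
  shows "invertible X \<longleftrightarrow> (\<forall>x. X *v x = 0 \<longrightarrow> x = 0)"
  by (simp add: invertible_left_inverse matrix_left_invertible_ker)

lemma matrix_inv_inverse:
  fixes X :: "real^'n^'n"
  assumes "invertible X"
  shows "X ** matrix_inv X = mat 1" "matrix_inv X ** X = mat 1"
  using someI_ex[OF assms[unfolded invertible_def]] by (auto simp: matrix_inv_def)

lemma block_matrix_mult:
  fixes z :: "real^('m::finite + 'n::finite)"
  defines "x \<equiv> \<chi> i. z $ Inl i" and "v \<equiv> \<chi> j. z $ Inr j"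
  shows "(block_matrix P Q R S *v z) $ Inl i = (P *v x + Q *v v) $ i"
    and "(block_matrix P Q R S *v z) $ Inr j = (R *v x + S *v v) $ j"
  by (simp_all add: matrix_vector_mult_def block_matrix_def x_def v_def
      sum.Plus UNIV_Plus_UNIV[symmetric] del: UNIV_Plus_UNIV)

text \<open>Block elimination on a kernel vector \<open>(x, v)\<close>: the first row gives
  \<open>x\<close> in terms of \<open>v\<close>, and substitution into the second leaves the Schur
  complement applied to \<open>v\<close>, up to sign.\<close>

lemma invertible_block_matrix:
  fixes P :: "real^'m::finite^'m" and Q :: "real^'n::finite^'m"
  assumes P: "invertible P" and schur: "invertible (R ** matrix_inv P ** Q)"
  shows "invertible (block_matrix P Q R 0)"
  unfolding invertible_iff_ker
proof (intro allI impI)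
  fix z :: "real^('m + 'n)"
  assume z: "block_matrix P Q R 0 *v z = 0"
  define x where "x = (\<chi> i. z $ Inl i)"
  define v where "v = (\<chi> j. z $ Inr j)"
  have eq: "P *v x + Q *v v = 0" "R *v x = 0"
    using block_matrix_mult[of P Q R 0 z] by (simp_all add: z vec_eq_iff x_def v_def)
  have "matrix_inv P *v (P *v x + Q *v v) = x + matrix_inv P *v (Q *v v)"
    using P by (simp add: matrix_vector_right_distrib matrix_vector_mul_assoc matrix_inv_inverse)
  then have x: "x = - (matrix_inv P *v (Q *v v))"
    using eq(1) by (simp add: eq_neg_iff_add_eq_0)
  then have "(R ** matrix_inv P ** Q) *v v = 0"
    using eq(2) by (simp add: matrix_vector_mul_assoc[symmetric] linear_neg[OF matrix_vector_mul_linear])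
  then have "v = 0"
    using schur by (simp add: invertible_iff_ker)
  then have "x = 0" using x by simp
  have "z $ k = 0" for k
    using \<open>v = 0\<close> \<open>x = 0\<close> by (cases k) (simp_all add: x_def v_def vec_eq_iff)
  then show "z = 0" by (simp add: vec_eq_iff)
qed

lemma inner_mat_A:
  assumes "invertible (mat_H Ls \<psi>)"
  obtains y where "mat_H Ls \<psi> *v y = mat_L Ls \<phi> \<psi> *v v"
    and "v \<bullet> (mat_A Ls \<phi> \<psi> *v v) = (norm (lincomb (\<lambda>i. Ls (\<psi> i)) y))\<^sup>2"
proof
  let ?H = "mat_H Ls \<psi>" and ?L = "mat_L Ls \<phi> \<psi>"
  let ?y = "matrix_inv ?H *v (?L *v v)"
  show Hy: "?H *v ?y = ?L *v v"
    using assms by (simp add: matrix_vector_mul_assoc matrix_inv_inverse matrix_mul_assoc)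
  have "v \<bullet> (mat_A Ls \<phi> \<psi> *v v) = v \<bullet> (transpose ?L *v ?y)"
    by (simp add: mat_A_def matrix_vector_mul_assoc matrix_mul_assoc)
  \<comment> \<open>Transposing moves \<open>?L\<close> back onto \<open>v\<close>, and
    \<open>?L *v v\<close> is \<open>?H *v ?y\<close>; symmetry of \<open>?H\<close> does not
    enter.\<close>
  also have "\<dots> = ?y \<bullet> (?H *v ?y)"
    by (metis Hy dot_lmul_matrix inner_commute transpose_matrix_vector)
  finally show "v \<bullet> (mat_A Ls \<phi> \<psi> *v v) = (norm (lincomb (\<lambda>i. Ls (\<psi> i)) ?y))\<^sup>2"
    by (simp add: inner_mat_H power2_norm_eq_inner)
qed

section \<open>Coercivity from the inf-sup condition\<close>

theorem theorem4p4:
  fixes \<Omega> :: "'d::euclidean_space set"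
    and b :: "'d \<Rightarrow> 'd" and c :: "'d \<Rightarrow> real" and B :: "'d L2 set"
    and L :: "'d L2 \<Rightarrow> 'd L2" and D :: "'d L2 set"
    and Ls :: "'d L2 \<Rightarrow> 'd L2" and Ds :: "'d L2 set"
    and U Z :: "'d L2 set"
    and \<phi> :: "'n::finite \<Rightarrow> 'd L2" and \<psi> :: "'m::finite \<Rightarrow> 'd L2"
    and c_P c_I :: real
  assumes domain: "open \<Omega>" "connected \<Omega>" "\<Omega> \<noteq> {}"
    and diff_op: "first_order_operator \<Omega> b c B D L"
    and closed_op: "closed_densely_defined (L2_on \<Omega>) D L"
    and Ds_def: "Ds = adjoint_domain (L2_on \<Omega>) D L"
    and Ls_def: "Ls = adjoint_op (L2_on \<Omega>) D L"
    and poincare: "c_P > 0" "\<forall>w\<in>Ds. c_P * norm w \<le> norm (Ls w)"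
    and surjective: "Ls ` Ds = L2_on \<Omega>"
    and trial_space: "U \<subseteq> D" "is_basis_of \<phi> U"
    and test_space: "Z \<subseteq> Ds" "is_basis_of \<psi> Z"
    and c_I: "c_I > 0"
    and inf_sup:
      "(INF v\<in>U - {0}. SUP w\<in>Z - {0}. \<bar>v \<bullet> Ls w\<bar> / (norm v * norm (Ls w))) \<ge> c_I"
  shows "(\<forall>v::real^'n. c_I\<^sup>2 * (v \<bullet> (mat_M \<phi> *v v)) \<le> v \<bullet> (mat_A Ls \<phi> \<psi> *v v))
    \<and> invertible (mat_A Ls \<phi> \<psi>)
    \<and> invertible (mat_AA Ls \<phi> \<psi>)"
proof -
  let ?H = "mat_H Ls \<psi>" and ?A = "mat_A Ls \<phi> \<psi>"
  let ?P = "lincomb \<phi>" and ?T = "lincomb (\<lambda>i. Ls (\<psi> i))"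
  note adj = adjoint_linear[OF closed_op subspace_L2_on, folded Ds_def Ls_def]
  have "range \<psi> \<subseteq> Ds"
    using test_space by (auto simp: is_basis_of_def intro: span_base)
  then have Ls_lincomb: "Ls (lincomb \<psi> x) = ?T x" for x
    using adj by (intro linear_on_lincomb[where V = Ds])
  \<comment> \<open>The Poincare-type bound makes the adjoint injective on \<open>Z\<close>, so the
    denominators in \<open>w\<close> are positive and \<open>?H\<close> has trivial kernel.\<close>
  have Ls_nonzero: "Ls w \<noteq> 0" if "w \<in> Z - {0}" for w
  proof
    assume "Ls w = 0"
    with that test_space(1) poincare(2) have "c_P * norm w \<le> 0" by force
    with that poincare(1) show False by (simp add: mult_le_0_iff)
  qed
  have H: "invertible ?H"
    unfolding invertible_iff_ker
  proof (intro allI impI)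
    fix x assume "?H *v x = 0"
    then have "?T x = 0"
      using inner_mat_H[of x Ls \<psi> x] by simp
    then have "lincomb \<psi> x = 0"
      using Ls_nonzero lincomb_mem[OF test_space(2), of x] by (metis DiffI Ls_lincomb singletonD)
    then show "x = 0"
      by (rule lincomb_eq_0_imp[OF test_space(2)])
  qed
  define q where "q v w = \<bar>v \<bullet> Ls w\<bar> / (norm v * norm (Ls w))" for v w
  \<comment> \<open>This holds even for zero arguments, where division by zero yields 0.\<close>
  have q_le_1: "q v w \<le> 1" for v w
    using Cauchy_Schwarz_ineq2[of v "Ls w"] by (auto simp: q_def divide_le_eq_1)
  \<comment> \<open>Infima and suprema of reals obey their order laws only for bounded sets. The
    bound 1 serves the supremum, and the resulting lower bound 0 lets the infimum be compared with
    each of its members.\<close>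
  have sup_nonneg: "0 \<le> (SUP w\<in>Z - {0}. q v w)" for v
  proof -
    obtain w where "w \<in> Z - {0}"
      using is_basis_of_nontrivial[OF test_space(2)] by blast
    moreover have "bdd_above (q v ` (Z - {0}))"
      using q_le_1 by (rule bdd_aboveI2)
    ultimately have "q v w \<le> (SUP w\<in>Z - {0}. q v w)"
      by (rule cSUP_upper)
    moreover have "0 \<le> q v w" by (simp add: q_def)
    ultimately show ?thesis by linarith
  qed
  have sup_ge: "c_I \<le> (SUP w\<in>Z - {0}. q v w)" if "v \<in> U - {0}" for v
  proof -
    have "bdd_below ((\<lambda>v. SUP w\<in>Z - {0}. q v w) ` (U - {0}))"
      using sup_nonneg by (rule bdd_belowI2)
    from cINF_lower[OF this that] inf_sup show ?thesis
      by (simp add: q_def)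
  qed
  have coercive: "c_I\<^sup>2 * (norm (?P v))\<^sup>2 \<le> v \<bullet> (?A *v v)" for v
  proof -
    obtain y where y: "?H *v y = mat_L Ls \<phi> \<psi> *v v" "v \<bullet> (?A *v v) = (norm (?T y))\<^sup>2"
      by (rule inner_mat_A[OF H])
    have "c_I * norm (?P v) \<le> norm (?T y)"
    proof (cases "?P v = 0")
      case False
      then have Pv: "?P v \<in> U - {0}"
        using lincomb_mem[OF trial_space(2)] by blast
      have "q (?P v) w \<le> norm (?T y) / norm (?P v)" if w: "w \<in> Z - {0}" for w
      proof -
        obtain x where x: "w = lincomb \<psi> x"
          using is_basis_of_imp_lincomb[OF test_space(2)] w by blast
        \<comment> \<open>Galerkin orthogonality: pairing
          \<open>?H *v y = mat_L Ls \<phi> \<psi> *v v\<close> with \<open>x\<close> says that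
          \<open>?P v - ?T y\<close> is orthogonal to \<open>Ls w\<close>.\<close>
        have "?P v \<bullet> Ls w = ?T y \<bullet> Ls w"
          using inner_mat_H[of x Ls \<psi> y] inner_mat_L[of x Ls \<phi> \<psi> v]
          by (simp add: y(1) x Ls_lincomb)
        then have "\<bar>?P v \<bullet> Ls w\<bar> \<le> norm (?T y) * norm (Ls w)"
          by (simp add: Cauchy_Schwarz_ineq2)
        then show ?thesis
          using Ls_nonzero[OF w] False by (simp add: q_def field_simps)
      qed
      then have "(SUP w\<in>Z - {0}. q (?P v) w) \<le> norm (?T y) / norm (?P v)"
        by (intro cSUP_least is_basis_of_nontrivial[OF test_space(2)])
      with sup_ge[OF Pv] have "c_I \<le> norm (?T y) / norm (?P v)" by linarith
      then show ?thesis using False by (simp add: pos_le_divide_eq)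
    qed simp
    then have "(c_I * norm (?P v))\<^sup>2 \<le> (norm (?T y))\<^sup>2"
      using c_I by (intro power_mono) auto
    then show ?thesis by (simp add: y(2) power_mult_distrib)
  qed
  have A: "invertible ?A"
    unfolding invertible_iff_ker
  proof (intro allI impI)
    fix v assume "?A *v v = 0"
    then have "?P v = 0"
      \<comment> \<open>The right-hand side of the coercivity estimate vanishes, which forces
        \<open>norm (?P v)\<close> to be 0.\<close>
      using coercive[of v] c_I by (simp add: mult_le_0_iff)
    then show "v = 0"
      by (rule lincomb_eq_0_imp[OF trial_space(2)])
  qed
  have "invertible (mat_AA Ls \<phi> \<psi>)"
    using invertible_block_matrix[OF H] A by (simp add: mat_AA_def mat_A_def)
  then show ?thesis
    using coercive A by (simp add: inner_mat_M power2_norm_eq_inner)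
qed

end
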